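(* Let $X$ be a set. Then: (1) A solution on $X$ is involutive if and only if it is diagonal. Furthermore, $R$ is an involutive solution on $X$ if and only if $(X,\cdot)$ is a rectangular semigroup and $R$ is defined for any $x,y\in X$ by $$R(x,y)=(x\cdot y,\ y\cdot x).$$ (2) For a decomposition of $X=A\times B$ as a product of two non-empty sets, a system of representatives for the isomorphism classes of all involutive solutions on $X$ is given by the maps $R:(A\times B)^2\to(A\times B)^2$ defined by $$R\bigl((a_1,b_1),(a_2,b_2)\bigr)=\bigl((a_1,b_2),(a_2,b_1)\bigr)$$ for all $a_1,a_2\in A$ and $b_1,b_2\in B$. For such an $R$, there exists an isomorphism of groups $\mathrm{Aut}(X,R)\cong\Sigma_A\times\Sigma_B$. In particular, if $X$ is a finite set with $|X|=n$, then the number of isomorphism classes of all involutive solutions on $X$ is equal to $\tau(n)$, the number of divisors of $n$.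
   Context: All sets are non-empty. $\Sigma_A$ is the group of all permutations of $A$. For a set $X$ let $\tau_X(x,y)=(y,x)$ be the flip map on $X\times X$. For a map $R:X\times X\to X\times X$ put, as maps $X^3\to X^3$, $R^{12}=R\times \mathrm{Id}_X$, $R^{23}=\mathrm{Id}_X\times R$, $R^{13}=(\mathrm{Id}_X\times\tau_X)\circ R^{12}\circ(\mathrm{Id}_X\times\tau_X)$. $R$ is called a solution on $X$ (of the set-theoretic Frobenius-Separability equation) if $R^{12}R^{23}=R^{23}R^{13}=R^{13}R^{12}$. The first component of $R(x,y)$ is written $x\cdot y$, which defines a binary operation $\cdot$ on $X$. An isomorphism of solutions $(X,R)\to(X',R')$ is a bijection $\sigma:X\to X'$ with $(\sigma\times\sigma)\circ R=R'\circ(\sigma\times\sigma)$; $\mathrm{Aut}(X,R)$ is the group of automorphisms of $(X,R)$. $R$ is involutive if $R^2=\mathrm{Id}_{X\times X}$, and diagonal if $R(x,x)=(x,x)$ for all $x\in X$. A semigroup is rectangular if $xyx=x$ for all its elements $x,y$. *)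

theory Defs
  imports "HOL-Algebra.Bij" "HOL-Library.Equipollence"
begin

(* A map R : X x X -> X x X on a set X is a function on the ambient type of X that maps X x X
   into itself; its values outside X x X are irrelevant to all notions below. *)

definition R12 :: "('a \<times> 'a \<Rightarrow> 'a \<times> 'a) \<Rightarrow> 'a \<times> 'a \<times> 'a \<Rightarrow> 'a \<times> 'a \<times> 'a" where
  "R12 R = (\<lambda>(x, y, z). let (u, v) = R (x, y) in (u, v, z))"

definition R23 :: "('a \<times> 'a \<Rightarrow> 'a \<times> 'a) \<Rightarrow> 'a \<times> 'a \<times> 'a \<Rightarrow> 'a \<times> 'a \<times> 'a" where
  "R23 R = map_prod id R"

definition R13 :: "('a \<times> 'a \<Rightarrow> 'a \<times> 'a) \<Rightarrow> 'a \<times> 'a \<times> 'a \<Rightarrow> 'a \<times> 'a \<times> 'a" where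
  "R13 R = map_prod id prod.swap \<circ> R12 R \<circ> map_prod id prod.swap"

definition solution :: "'a set \<Rightarrow> ('a \<times> 'a \<Rightarrow> 'a \<times> 'a) \<Rightarrow> bool" where
  "solution X R \<longleftrightarrow> R \<in> X \<times> X \<rightarrow> X \<times> X \<and>
     (\<forall>t \<in> X \<times> X \<times> X. (R12 R \<circ> R23 R) t = (R23 R \<circ> R13 R) t \<and>
                       (R23 R \<circ> R13 R) t = (R13 R \<circ> R12 R) t)"

definition involutive :: "'a set \<Rightarrow> ('a \<times> 'a \<Rightarrow> 'a \<times> 'a) \<Rightarrow> bool" where
  "involutive X R \<longleftrightarrow> (\<forall>p \<in> X \<times> X. R (R p) = p)"

definition diagonal :: "'a set \<Rightarrow> ('a \<times> 'a \<Rightarrow> 'a \<times> 'a) \<Rightarrow> bool" where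
  "diagonal X R \<longleftrightarrow> (\<forall>x \<in> X. R (x, x) = (x, x))"

definition dot :: "('a \<times> 'a \<Rightarrow> 'a \<times> 'a) \<Rightarrow> 'a \<Rightarrow> 'a \<Rightarrow> 'a" where
  "dot R x y = fst (R (x, y))"

definition semigroup_on :: "'a set \<Rightarrow> ('a \<Rightarrow> 'a \<Rightarrow> 'a) \<Rightarrow> bool" where
  "semigroup_on X m \<longleftrightarrow> (\<forall>x \<in> X. \<forall>y \<in> X. m x y \<in> X) \<and>
     (\<forall>x \<in> X. \<forall>y \<in> X. \<forall>z \<in> X. m (m x y) z = m x (m y z))"

definition rectangular_semigroup :: "'a set \<Rightarrow> ('a \<Rightarrow> 'a \<Rightarrow> 'a) \<Rightarrow> bool" where
  "rectangular_semigroup X m \<longleftrightarrow> semigroup_on X m \<and> (\<forall>x \<in> X. \<forall>y \<in> X. m (m x y) x = x)"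

definition solution_iso ::
  "'a set \<Rightarrow> ('a \<times> 'a \<Rightarrow> 'a \<times> 'a) \<Rightarrow> 'b set \<Rightarrow> ('b \<times> 'b \<Rightarrow> 'b \<times> 'b) \<Rightarrow> ('a \<Rightarrow> 'b) \<Rightarrow> bool" where
  "solution_iso X R X' R' \<sigma> \<longleftrightarrow> bij_betw \<sigma> X X' \<and>
     (\<forall>p \<in> X \<times> X. (map_prod \<sigma> \<sigma> \<circ> R) p = (R' \<circ> map_prod \<sigma> \<sigma>) p)"

definition Aut_solution :: "'a set \<Rightarrow> ('a \<times> 'a \<Rightarrow> 'a \<times> 'a) \<Rightarrow> ('a \<Rightarrow> 'a) monoid" where
  "Aut_solution X R = BijGroup X \<lparr>carrier := {\<sigma> \<in> Bij X. solution_iso X R X R \<sigma>}\<rparr>"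

definition involutive_solutions :: "'a set \<Rightarrow> ('a \<times> 'a \<Rightarrow> 'a \<times> 'a) set" where
  "involutive_solutions X = {R. solution X R \<and> involutive X R}"

(* Two functions that agree on X x X, i.e. that represent the same map on X x X, are isomorphic
   via the identity, so the classes of this relation are the isomorphism classes of maps. *)
definition isomorphism_rel ::
  "'a set \<Rightarrow> (('a \<times> 'a \<Rightarrow> 'a \<times> 'a) \<times> ('a \<times> 'a \<Rightarrow> 'a \<times> 'a)) set" where
  "isomorphism_rel X = {(R, R'). R \<in> involutive_solutions X \<and> R' \<in> involutive_solutions X \<and>
     (\<exists>\<sigma>. solution_iso X R X R' \<sigma>)}"

definition system_of_representatives :: "'s set \<Rightarrow> 's set \<Rightarrow> ('s \<times> 's) set \<Rightarrow> bool" where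
  "system_of_representatives S M r \<longleftrightarrow> S \<subseteq> M \<and> (\<forall>x \<in> M. \<exists>!s. s \<in> S \<and> (x, s) \<in> r)"

(* A decomposition X = A x B of an abstract set X includes the identification \<phi> of A x B
   with X; for X literally equal to A x B one may take \<phi> = id. *)
definition decomposition :: "'a set \<Rightarrow> 'b set \<Rightarrow> 'c set \<Rightarrow> ('b \<times> 'c \<Rightarrow> 'a) \<Rightarrow> bool" where
  "decomposition X A B \<phi> \<longleftrightarrow> A \<noteq> {} \<and> B \<noteq> {} \<and> bij_betw \<phi> (A \<times> B) X"

definition product_solution :: "('b \<times> 'c) \<times> ('b \<times> 'c) \<Rightarrow> ('b \<times> 'c) \<times> ('b \<times> 'c)" where
  "product_solution = (\<lambda>((a1, b1), (a2, b2)). ((a1, b2), (a2, b1)))"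

definition decomposition_solution ::
  "'b set \<Rightarrow> 'c set \<Rightarrow> ('b \<times> 'c \<Rightarrow> 'a) \<Rightarrow> 'a \<times> 'a \<Rightarrow> 'a \<times> 'a" where
  "decomposition_solution A B \<phi> =
     map_prod \<phi> \<phi> \<circ> product_solution \<circ> map_prod (inv_into (A \<times> B) \<phi>) (inv_into (A \<times> B) \<phi>)"

lemma decomposition_solution_apply:
  assumes "decomposition X A B \<phi>" "a1 \<in> A" "a2 \<in> A" "b1 \<in> B" "b2 \<in> B"
  shows "decomposition_solution A B \<phi> (\<phi> (a1, b1), \<phi> (a2, b2)) = (\<phi> (a1, b2), \<phi> (a2, b1))"
  using assms
  by (simp add: decomposition_def decomposition_solution_def product_solution_def bij_betw_def)

lemma decomposition_solution_id:
  assumes "p \<in> (A \<times> B) \<times> (A \<times> B)"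
  shows "decomposition_solution A B id p = product_solution p"
  using assms inv_into_f_f[of id "A \<times> B"]
  by (auto simp: decomposition_solution_def product_solution_def)

(* A and B embed into X, so subsets of the ambient type of X suffice to obtain, up to
   bijections of the factors, all decompositions of X. *)
definition decompositions :: "'a set \<Rightarrow> ('a set \<times> 'a set \<times> ('a \<times> 'a \<Rightarrow> 'a)) set" where
  "decompositions X = {(A, B, \<phi>). decomposition X A B \<phi>}"

definition same_type ::
  "(('a set \<times> 'a set \<times> ('a \<times> 'a \<Rightarrow> 'a)) \<times> ('a set \<times> 'a set \<times> ('a \<times> 'a \<Rightarrow> 'a))) set" where
  "same_type = {((A, B, \<phi>), (A', B', \<phi>')). A \<approx> A' \<and> B \<approx> B'}"

lemma subgroup_Aut_solution:
  assumes R: "R \<in> X \<times> X \<rightarrow> X \<times> X"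
  shows "subgroup (carrier (Aut_solution X R)) (BijGroup X)"
proof -
  interpret G: group "BijGroup X" by (rule group_BijGroup)
  let ?H = "{\<sigma> \<in> Bij X. solution_iso X R X R \<sigma>}"
  have iso_iff: "\<sigma> \<in> ?H \<longleftrightarrow> \<sigma> \<in> Bij X \<and>
      (\<forall>p \<in> X \<times> X. map_prod \<sigma> \<sigma> (R p) = R (map_prod \<sigma> \<sigma> p))" for \<sigma>
    by (auto simp: solution_iso_def Bij_def)
  have comm: "map_prod s s (R p) = R (map_prod s s p)" if "s \<in> ?H" "p \<in> X \<times> X" for s p
    using that(1)[unfolded iso_iff] that(2) by blast
  have comp: "map_prod (compose X s t) (compose X s t) p = map_prod s s (map_prod t t p)"
    if "p \<in> X \<times> X" for s t :: "'a \<Rightarrow> 'a" and p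
    using that by (auto simp: compose_def)
  have closed: "map_prod s s p \<in> X \<times> X" if "s \<in> Bij X" "p \<in> X \<times> X" for s p
    using that Bij_imp_funcset[of s X] by auto
  have inj: "p = q" if "s \<in> Bij X" "p \<in> X \<times> X" "q \<in> X \<times> X" "map_prod s s p = map_prod s s q"
    for s p q
  proof -
    have "inj_on s X" using that by (simp add: Bij_def bij_betw_def)
    then have "inj_on (map_prod s s) (X \<times> X)" by (simp add: map_prod_inj_on)
    then show ?thesis using that by (simp only: inj_on_def)
  qed
  have "subgroup ?H (BijGroup X)"
  proof
    show "?H \<subseteq> carrier (BijGroup X)" by (auto simp: BijGroup_def)
    show "\<one>\<^bsub>BijGroup X\<^esub> \<in> ?H"
    proof -
      have "map_prod (\<lambda>x\<in>X. x) (\<lambda>x\<in>X. x) p = p" if "p \<in> X \<times> X" for p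
        using that by auto
      then have "(\<lambda>x\<in>X. x) \<in> ?H"
        unfolding iso_iff by (metis R funcset_mem id_Bij)
      then show ?thesis by (simp add: BijGroup_def)
    qed
    fix s assume s: "s \<in> ?H"
    show "s \<otimes>\<^bsub>BijGroup X\<^esub> t \<in> ?H" if t: "t \<in> ?H" for t
    proof -
      have "map_prod (compose X s t) (compose X s t) (R p) = R (map_prod (compose X s t) (compose X s t) p)"
        if p: "p \<in> X \<times> X" for p
      proof -
        have tp: "map_prod t t p \<in> X \<times> X" using closed p t by blast
        have "map_prod t t (R p) = R (map_prod t t p)" by (rule comm[OF t p])
        moreover have "map_prod s s (R (map_prod t t p)) = R (map_prod s s (map_prod t t p))"
          by (rule comm[OF s tp])
        ultimately show ?thesis
          by (simp only: comp[OF p] comp[OF funcset_mem[OF R p]])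
      qed
      moreover have "compose X s t \<in> Bij X" using s t compose_Bij unfolding iso_iff by blast
      ultimately show ?thesis
        using s t unfolding iso_iff by (simp add: BijGroup_def)
    qed
    define t where "t = inv\<^bsub>BijGroup X\<^esub> s"
    have sB: "s \<in> Bij X" using s by simp
    then have tB: "t \<in> Bij X" using G.inv_closed[of s] by (simp add: t_def BijGroup_def)
    have "compose X s t = (\<lambda>x\<in>X. x)"
      using G.r_inv[of s] sB tB by (simp add: t_def[symmetric]) (simp add: BijGroup_def)
    then have st: "map_prod s s (map_prod t t p) = p" if "p \<in> X \<times> X" for p
      using comp[OF that, of s t] that by auto
    have "map_prod t t (R p) = R (map_prod t t p)" if p: "p \<in> X \<times> X" for p
    proof (rule inj[OF sB])
      note c = closed[OF tB p] and Rp = funcset_mem[OF R p]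
      show "map_prod t t (R p) \<in> X \<times> X" using closed[OF tB Rp] .
      show "R (map_prod t t p) \<in> X \<times> X" using funcset_mem[OF R c] .
      show "map_prod s s (map_prod t t (R p)) = map_prod s s (R (map_prod t t p))"
      proof -
        have "map_prod s s (R (map_prod t t p)) = R (map_prod s s (map_prod t t p))"
          by (rule comm[OF s c])
        then show ?thesis by (simp only: st[OF p] st[OF Rp])
      qed
    qed
    then show "inv\<^bsub>BijGroup X\<^esub> s \<in> ?H" using tB unfolding iso_iff t_def by blast
  qed
  then show ?thesis by (simp add: Aut_solution_def)
qed

end

theory Submission
  imports Defs
begin

text \<open>
  Write \<open>R (x, y) = (x y, g x y)\<close>. Comparing the three components of the equation gives six
  identities in the product and \<open>g\<close>, and they collapse \<open>R\<^sup>2\<close> to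
  \<open>(x, y) \<mapsto> (g x x, g y y)\<close> (\<open>solution_square\<close>). Hence \<open>R\<close> is involutive exactly when
  \<open>g x x = x\<close> for all \<open>x\<close>, and since \<open>x (g x x) = g x x\<close> this is the same as being diagonal. The
  identity \<open>y (g x z) = g x y\<close> at \<open>z = x\<close> then yields \<open>g x y = y x\<close>, and the identities that are
  left say that the product is a rectangular semigroup, in which middle factors may be deleted.

  A rectangular semigroup \<open>X\<close> with a chosen element \<open>e\<close> is the product of \<open>X e\<close> and \<open>e X\<close> under
  \<open>(a, b) \<mapsto> a b\<close>, so every involutive solution is the solution of a decomposition
  (\<open>involutive_solution_decomposition\<close>). Isomorphisms between two such solutions are exactly the
  products of a bijection of the first factors with a bijection of the second factors
  (\<open>solution_iso_decomposition_iff\<close>). This one fact determines both the isomorphism classes, which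
  correspond to the pairs of cardinalities of the two factors, and the automorphism groups.
  When \<open>X\<close> is finite, such a pair is a factorisation of \<open>card X\<close> and is given by its first
  entry, a divisor; any divisor occurs.
\<close>

section \<open>Involutive solutions and rectangular semigroups\<close>

lemma R12_apply: "R12 R (x, y, z) = (fst (R (x, y)), snd (R (x, y)), z)"
  by (simp add: R12_def split: prod.split)

lemma R23_apply: "R23 R (x, y, z) = (x, fst (R (y, z)), snd (R (y, z)))"
  by (simp add: R23_def)

lemma R13_apply: "R13 R (x, y, z) = (fst (R (x, z)), y, snd (R (x, z)))"
  by (simp add: R13_def R12_apply)

text \<open>
  The three maps in the equation send \<open>(x, y, z)\<close> to \<open>(x (y z), g x (y z), g y z)\<close>,
  \<open>(x z, y (g x z), g y (g x z))\<close> and \<open>((x y) z, g x y, g (x y) z)\<close>. In each component the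
  shortest of the three terms serves as the common right-hand side.
\<close>

lemma solution_iff:
  fixes R :: "'a \<times> 'a \<Rightarrow> 'a \<times> 'a"
  defines "g \<equiv> \<lambda>x y. snd (R (x, y))"
  shows "solution X R \<longleftrightarrow> R \<in> X \<times> X \<rightarrow> X \<times> X \<and>
     (\<forall>x\<in>X. \<forall>y\<in>X. \<forall>z\<in>X.
        dot R x (dot R y z) = dot R x z \<and> dot R (dot R x y) z = dot R x z \<and>
        g x (dot R y z) = g x y \<and> dot R y (g x z) = g x y \<and>
        g y (g x z) = g y z \<and> g (dot R x y) z = g y z)"
proof -
  have "(R12 R \<circ> R23 R) (x, y, z) = (R23 R \<circ> R13 R) (x, y, z) \<and>
        (R23 R \<circ> R13 R) (x, y, z) = (R13 R \<circ> R12 R) (x, y, z) \<longleftrightarrow>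
        dot R x (dot R y z) = dot R x z \<and> dot R (dot R x y) z = dot R x z \<and>
        g x (dot R y z) = g x y \<and> dot R y (g x z) = g x y \<and>
        g y (g x z) = g y z \<and> g (dot R x y) z = g y z" for x y z
    by (simp only: o_apply R12_apply R23_apply R13_apply prod_eq_iff fst_conv snd_conv g_def dot_def)
      metis
  then show ?thesis
    unfolding solution_def by (simp only: mem_Times_iff split_paired_Ball_Sigma Ball_def split_paired_All fst_conv snd_conv) blast
qed

lemma solution_dot_closed:
  assumes "solution X R" "x \<in> X" "y \<in> X"
  shows "dot R x y \<in> X" "snd (R (x, y)) \<in> X"
  using assms funcset_mem[of R "X \<times> X" "X \<times> X" "(x, y)"]
  by (auto simp: solution_def dot_def mem_Times_iff)

text \<open>
  The first component is \<open>(x y) (g x y) = x (g x y) = g x x\<close> and the second is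
  \<open>g (x y) (g x y) = g y (g x y) = g y y\<close>.
\<close>

lemma solution_square:
  assumes R: "solution X R" and x: "x \<in> X" and y: "y \<in> X"
  shows "R (R (x, y)) = (snd (R (x, x)), snd (R (y, y)))"
proof -
  define g where "g = (\<lambda>x y. snd (R (x, y)))"
  note eq = R[unfolded solution_iff, folded g_def, THEN conjunct2, rule_format]
  have gX: "g x y \<in> X" using solution_dot_closed[OF R x y] by (simp add: g_def)
  have "R (x, y) = (dot R x y, g x y)" by (simp add: dot_def g_def)
  moreover have "dot R (dot R x y) (g x y) = g x x"
    using eq[OF x y gX] eq[OF x x y] by (simp add: g_def)
  moreover have "g (dot R x y) (g x y) = g y y"
    using eq[OF x y gX] eq[OF x y y] by (simp add: g_def)
  ultimately show ?thesis by (simp add: dot_def g_def prod_eq_iff)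
qed

lemma involutive_iff_diagonal:
  assumes R: "solution X R"
  shows "involutive X R \<longleftrightarrow> diagonal X R"
proof -
  have "dot R x (snd (R (x, x))) = snd (R (x, x))" if "x \<in> X" for x
    using R that unfolding solution_iff by blast
  then have "diagonal X R \<longleftrightarrow> (\<forall>x\<in>X. snd (R (x, x)) = x)"
    by (auto simp: diagonal_def dot_def prod_eq_iff)
  also have "\<dots> \<longleftrightarrow> involutive X R"
    using solution_square[OF R] by (auto simp: involutive_def)
  finally show ?thesis ..
qed

text \<open>
  Associativity and this cancellation are all that the verification of the equation uses.
\<close>

lemma rectangular_middle:
  assumes m: "rectangular_semigroup X m" and "x \<in> X" "y \<in> X" "z \<in> X"
  shows "m (m x y) z = m x z"
proof -
  have cl: "m u v \<in> X" if "u \<in> X" "v \<in> X" for u v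
    using m that by (auto simp: rectangular_semigroup_def semigroup_on_def)
  have as: "m (m u v) w = m u (m v w)" if "u \<in> X" "v \<in> X" "w \<in> X" for u v w
    using m that by (auto simp: rectangular_semigroup_def semigroup_on_def)
  have rc: "m u (m v u) = u" if "u \<in> X" "v \<in> X" for u v
    using m that as by (auto simp: rectangular_semigroup_def)
  \<comment> \<open>The detour is \<open>x y z = x y (z x z) = (x (y z) x) z = x z\<close>.\<close>
  have "m (m x y) z = m x (m y (m z (m x z)))" using assms(2-4) as rc by simp
  also have "\<dots> = m (m x (m (m y z) x)) z" using assms(2-4) as cl by simp
  also have "\<dots> = m x z" using assms(2-4) rc cl by simp
  finally show ?thesis .
qed

lemma rectangular_idem:
  assumes m: "rectangular_semigroup X m" and x: "x \<in> X"
  shows "m x x = x"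
  using rectangular_middle[OF m x x x] m x by (simp add: rectangular_semigroup_def)

lemma involutive_solution_iff_rectangular:
  assumes RX: "R \<in> X \<times> X \<rightarrow> X \<times> X"
  shows "solution X R \<and> involutive X R \<longleftrightarrow>
    rectangular_semigroup X (dot R) \<and> (\<forall>x\<in>X. \<forall>y\<in>X. R (x, y) = (dot R x y, dot R y x))"
    (is "?L \<longleftrightarrow> ?R")
proof
  assume ?L
  then have R: "solution X R" by simp
  have diag: "R (x, x) = (x, x)" if "x \<in> X" for x
    using \<open>?L\<close> that involutive_iff_diagonal by (auto simp: diagonal_def)
  note eq = R[unfolded solution_iff, THEN conjunct2, rule_format]
  have idem: "dot R x x = x" if "x \<in> X" for x using diag[OF that] by (simp add: dot_def)
  have "snd (R (x, y)) = dot R y x" if "x \<in> X" "y \<in> X" for x y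
  proof -
    have "dot R y (snd (R (x, x))) = snd (R (x, y))" using eq that by blast
    then show ?thesis using diag[OF that(1)] by simp
  qed
  then have "\<forall>x\<in>X. \<forall>y\<in>X. R (x, y) = (dot R x y, dot R y x)"
    by (auto simp: dot_def prod_eq_iff)
  moreover have "rectangular_semigroup X (dot R)"
    using eq idem solution_dot_closed[OF R]
    by (auto simp: rectangular_semigroup_def semigroup_on_def)
  ultimately show ?R by blast
next
  assume ?R
  then have m: "rectangular_semigroup X (dot R)"
    and RR: "\<And>x y. x \<in> X \<Longrightarrow> y \<in> X \<Longrightarrow> R (x, y) = (dot R x y, dot R y x)" by auto
  have cl: "dot R x y \<in> X" if "x \<in> X" "y \<in> X" for x y
    using m that by (auto simp: rectangular_semigroup_def semigroup_on_def)
  note mid = rectangular_middle[OF m]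
  have mid': "dot R x (dot R y z) = dot R x z" if "x \<in> X" "y \<in> X" "z \<in> X" for x y z
    using mid[OF that] m that by (auto simp: rectangular_semigroup_def semigroup_on_def)
  have R: "solution X R"
    unfolding solution_iff using RX by (simp add: RR cl mid mid')
  moreover have "diagonal X R"
    using RR rectangular_idem[OF m] by (simp add: diagonal_def)
  ultimately show ?L using involutive_iff_diagonal by blast
qed

section \<open>Decompositions and their solutions\<close>

lemma decomposition_cases:
  assumes "decomposition X A B \<phi>" "x \<in> X"
  obtains a b where "a \<in> A" "b \<in> B" "x = \<phi> (a, b)"
  using assms by (force simp: decomposition_def bij_betw_def)

lemma decomposition_mem:
  assumes "decomposition X A B \<phi>" "a \<in> A" "b \<in> B"
  shows "\<phi> (a, b) \<in> X"
  using assms by (auto simp: decomposition_def bij_betw_def)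

lemma decomposition_eq_iff:
  assumes "decomposition X A B \<phi>" "a \<in> A" "b \<in> B" "a' \<in> A" "b' \<in> B"
  shows "\<phi> (a, b) = \<phi> (a', b') \<longleftrightarrow> a = a' \<and> b = b'"
  using assms by (auto simp: decomposition_def bij_betw_def inj_on_eq_iff)

text \<open>
  The product of such a solution is \<open>(a1, b1) (a2, b2) = (a1, b2)\<close>, which is visibly a rectangular
  semigroup.
\<close>

lemma decomposition_solution_involutive:
  assumes D: "decomposition X A B \<phi>"
  shows "decomposition_solution A B \<phi> \<in> involutive_solutions X"
proof -
  let ?R = "decomposition_solution A B \<phi>"
  note [simp] = decomposition_solution_apply[OF D] decomposition_mem[OF D]
  have "?R \<in> X \<times> X \<rightarrow> X \<times> X"
    by (auto elim!: decomposition_cases[OF D])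
  moreover have "\<forall>x\<in>X. \<forall>y\<in>X. ?R (x, y) = (dot ?R x y, dot ?R y x)"
    unfolding dot_def by (auto elim!: decomposition_cases[OF D])
  moreover have "rectangular_semigroup X (dot ?R)"
    unfolding rectangular_semigroup_def semigroup_on_def dot_def
    by (auto elim!: decomposition_cases[OF D])
  ultimately show ?thesis
    unfolding involutive_solutions_def using involutive_solution_iff_rectangular by blast
qed

text \<open>
  Middle factors cancel, so \<open>x = (x e) (e x)\<close>, while \<open>((x e) (e y)) e = x e\<close> and
  \<open>e ((x e) (e y)) = e y\<close>. Thus \<open>x \<mapsto> (x e, e x)\<close> is inverse to the multiplication
  \<open>X e \<times> e X \<rightarrow> X\<close>. The two factors are obtained as subsets of \<open>X\<close>, the form in which
  decompositions are later classified.
\<close>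

lemma involutive_solution_decomposition:
  fixes X :: "'a set"
  assumes "X \<noteq> {}" and R: "R \<in> involutive_solutions X"
  obtains A B :: "'a set" and \<phi> :: "'a \<times> 'a \<Rightarrow> 'a" where "decomposition X A B \<phi>"
    "\<forall>p\<in>X \<times> X. R p = decomposition_solution A B \<phi> p"
proof -
  have RX: "R \<in> X \<times> X \<rightarrow> X \<times> X"
    using R by (simp add: involutive_solutions_def solution_def)
  have m: "rectangular_semigroup X (dot R)"
    and RR: "R (x, y) = (dot R x y, dot R y x)" if "x \<in> X" "y \<in> X" for x y
    using R that involutive_solution_iff_rectangular[OF RX]
    unfolding involutive_solutions_def by blast+
  obtain e where e: "e \<in> X" using \<open>X \<noteq> {}\<close> by blast
  note m = m[OF e e]
  have cl: "dot R x y \<in> X" if "x \<in> X" "y \<in> X" for x y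
    using m that by (auto simp: rectangular_semigroup_def semigroup_on_def)
  note mid = rectangular_middle[OF m]
  have mid': "dot R x (dot R y z) = dot R x z" if "x \<in> X" "y \<in> X" "z \<in> X" for x y z
    using mid[OF that] m that by (auto simp: rectangular_semigroup_def semigroup_on_def)
  note idem = rectangular_idem[OF m]
  define A where "A = (\<lambda>x. dot R x e) ` X"
  define B where "B = (\<lambda>x. dot R e x) ` X"
  define \<phi> where "\<phi> = (\<lambda>(a, b). dot R a b)"
  have D: "decomposition X A B \<phi>"
    unfolding decomposition_def
  proof (intro conjI)
    show "A \<noteq> {}" "B \<noteq> {}" using e by (auto simp: A_def B_def)
    show "bij_betw \<phi> (A \<times> B) X"
      by (rule bij_betwI[where g = "\<lambda>x. (dot R x e, dot R e x)"])
        (auto simp: A_def B_def \<phi>_def e cl mid mid' idem)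
  qed
  moreover have "R p = decomposition_solution A B \<phi> p" if "p \<in> X \<times> X" for p
  proof -
    obtain x y where p: "p = (x, y)" "x \<in> X" "y \<in> X" using \<open>p \<in> X \<times> X\<close> by blast
    have *: "z = \<phi> (dot R z e, dot R e z)" "dot R z e \<in> A" "dot R e z \<in> B" if "z \<in> X" for z
      using that by (auto simp: A_def B_def \<phi>_def e cl mid mid' idem)
    have "decomposition_solution A B \<phi> p =
        (\<phi> (dot R x e, dot R e y), \<phi> (dot R y e, dot R e x))"
      using decomposition_solution_apply[OF D *(2)[OF p(2)] *(2)[OF p(3)] *(3)[OF p(2)] *(3)[OF p(3)]]
        *(1)[OF p(2)] *(1)[OF p(3)] p(1) by simp
    also have "\<dots> = R p"
      using p e RR by (simp add: \<phi>_def cl mid mid')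
    finally show ?thesis ..
  qed
  ultimately show thesis using that by blast
qed

section \<open>Isomorphisms between the solutions of decompositions\<close>

text \<open>
  The point \<open>(a, b)\<close> is the first component of \<open>R ((a, b0), (a0, b))\<close>. An isomorphism therefore
  sends it to the pair of the first coordinate of the image of \<open>(a, b0)\<close> and the second coordinate
  of the image of \<open>(a0, b)\<close>, and so it splits. Each half is a bijection because their product is
  one and no factor is empty.
\<close>

lemma solution_iso_decomposition_iff:
  assumes D: "decomposition X A B \<phi>" and D': "decomposition X' A' B' \<phi>'"
  shows "solution_iso X (decomposition_solution A B \<phi>) X' (decomposition_solution A' B' \<phi>') \<sigma> \<longleftrightarrow>
    (\<exists>\<alpha> \<beta>. bij_betw \<alpha> A A' \<and> bij_betw \<beta> B B' \<and>
       (\<forall>a\<in>A. \<forall>b\<in>B. \<sigma> (\<phi> (a, b)) = \<phi>' (\<alpha> a, \<beta> b)))" (is "?L \<longleftrightarrow> ?split")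
proof
  let ?R = "decomposition_solution A B \<phi>" and ?R' = "decomposition_solution A' B' \<phi>'"
  assume ?L
  then have bij: "bij_betw \<sigma> X X'"
    and hom: "\<And>x y. x \<in> X \<Longrightarrow> y \<in> X \<Longrightarrow> map_prod \<sigma> \<sigma> (?R (x, y)) = ?R' (\<sigma> x, \<sigma> y)"
    by (auto simp: solution_iso_def)
  obtain a0 b0 where a0: "a0 \<in> A" and b0: "b0 \<in> B"
    using D by (auto simp: decomposition_def)
  have ex: "\<exists>q. q \<in> A' \<times> B' \<and> \<sigma> (\<phi> (a, b)) = \<phi>' q" if "a \<in> A" "b \<in> B" for a b
    using decomposition_cases[OF D', of "\<sigma> (\<phi> (a, b))"] decomposition_mem[OF D that] bij
    by (metis SigmaI bij_betwE)
  \<comment> \<open>\<open>h\<close> is \<open>\<sigma>\<close> read in the coordinates of the two decompositions.\<close>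
  obtain h where h: "\<And>a b. a \<in> A \<Longrightarrow> b \<in> B \<Longrightarrow> h a b \<in> A' \<times> B' \<and> \<sigma> (\<phi> (a, b)) = \<phi>' (h a b)"
    using ex by metis
  define \<alpha> where "\<alpha> a = fst (h a b0)" for a
  define \<beta> where "\<beta> b = snd (h a0 b)" for b
  have mem: "\<alpha> a \<in> A'" "\<beta> b \<in> B'" if "a \<in> A" "b \<in> B" for a b
    using that h a0 b0 by (auto simp: \<alpha>_def \<beta>_def mem_Times_iff)
  have split: "\<sigma> (\<phi> (a, b)) = \<phi>' (\<alpha> a, \<beta> b)" if a: "a \<in> A" and b: "b \<in> B" for a b
  proof -
    have "map_prod \<sigma> \<sigma> (?R (\<phi> (a, b0), \<phi> (a0, b))) = ?R' (\<phi>' (h a b0), \<phi>' (h a0 b))"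
      using hom[of "\<phi> (a, b0)" "\<phi> (a0, b)"] decomposition_mem[OF D] h a b a0 b0 by simp
    moreover have "?R (\<phi> (a, b0), \<phi> (a0, b)) = (\<phi> (a, b), \<phi> (a0, b0))"
      using decomposition_solution_apply[OF D] a b a0 b0 by simp
    moreover have "?R' (\<phi>' (h a b0), \<phi>' (h a0 b)) =
        (\<phi>' (\<alpha> a, \<beta> b), \<phi>' (fst (h a0 b), snd (h a b0)))"
      using decomposition_solution_apply[OF D', of "fst (h a b0)" "fst (h a0 b)"
          "snd (h a b0)" "snd (h a0 b)"] h[OF a b0] h[OF a0 b]
      by (simp add: \<alpha>_def \<beta>_def mem_Times_iff)
    ultimately show ?thesis by simp
  qed
  have inj: "a = a' \<and> b = b'"
    if "\<alpha> a = \<alpha> a'" "\<beta> b = \<beta> b'" "a \<in> A" "a' \<in> A" "b \<in> B" "b' \<in> B" for a a' b b'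
  proof -
    have "\<sigma> (\<phi> (a, b)) = \<sigma> (\<phi> (a', b'))" using split that by simp
    then have "\<phi> (a, b) = \<phi> (a', b')"
      using bij decomposition_mem[OF D] that by (auto simp: bij_betw_def inj_on_eq_iff)
    then show ?thesis using decomposition_eq_iff[OF D] that by simp
  qed
  have surj: "\<exists>a\<in>A. \<exists>b\<in>B. \<alpha> a = a' \<and> \<beta> b = b'" if "a' \<in> A'" "b' \<in> B'" for a' b'
  proof -
    have "\<phi>' (a', b') \<in> \<sigma> ` X"
      using decomposition_mem[OF D' that] bij by (simp add: bij_betw_def)
    then obtain x where x: "x \<in> X" "\<sigma> x = \<phi>' (a', b')" by auto
    obtain a b where "a \<in> A" "b \<in> B" "x = \<phi> (a, b)" by (rule decomposition_cases[OF D x(1)])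
    with x split mem decomposition_eq_iff[OF D'] that show ?thesis by metis
  qed
  have "A' \<noteq> {}" "B' \<noteq> {}" using D' by (auto simp: decomposition_def)
  then have "bij_betw \<alpha> A A'" "bij_betw \<beta> B B'"
    using inj a0 b0 mem surj unfolding bij_betw_def inj_on_def by blast+
  with split show ?split by blast
next
  assume ?split
  then obtain \<alpha> \<beta> where \<alpha>: "bij_betw \<alpha> A A'" and \<beta>: "bij_betw \<beta> B B'"
    and split: "\<And>a b. a \<in> A \<Longrightarrow> b \<in> B \<Longrightarrow> \<sigma> (\<phi> (a, b)) = \<phi>' (\<alpha> a, \<beta> b)" by blast
  have mem: "\<alpha> a \<in> A'" "\<beta> b \<in> B'" if "a \<in> A" "b \<in> B" for a b
    using that \<alpha> \<beta> by (auto simp: bij_betw_def)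
  have "inj_on \<sigma> X"
    using \<alpha> \<beta> mem
    by (auto intro!: inj_onI elim!: decomposition_cases[OF D]
        simp: split decomposition_eq_iff[OF D'] decomposition_eq_iff[OF D] bij_betw_def inj_on_eq_iff)
  moreover have "\<sigma> ` X = X'"
  proof
    show "\<sigma> ` X \<subseteq> X'"
      using mem by (auto elim!: decomposition_cases[OF D] simp: split decomposition_mem[OF D'])
    show "X' \<subseteq> \<sigma> ` X"
    proof
      fix x assume "x \<in> X'"
      then obtain a' b' where "a' \<in> A'" "b' \<in> B'" "x = \<phi>' (a', b')"
        by (rule decomposition_cases[OF D'])
      moreover then obtain a b where "a \<in> A" "b \<in> B" "a' = \<alpha> a" "b' = \<beta> b"
        using \<alpha> \<beta> by (auto simp: bij_betw_def)
      ultimately have "x = \<sigma> (\<phi> (a, b))" "\<phi> (a, b) \<in> X"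
        using split decomposition_mem[OF D] by auto
      then show "x \<in> \<sigma> ` X" by blast
    qed
  qed
  ultimately have "bij_betw \<sigma> X X'" by (simp add: bij_betw_def)
  moreover have "map_prod \<sigma> \<sigma> (decomposition_solution A B \<phi> (x, y)) =
      decomposition_solution A' B' \<phi>' (\<sigma> x, \<sigma> y)" if "x \<in> X" "y \<in> X" for x y
    using that mem
    by (auto elim!: decomposition_cases[OF D]
        simp: split decomposition_solution_apply[OF D] decomposition_solution_apply[OF D'])
  ultimately show ?L by (auto simp: solution_iso_def)
qed

lemma isomorphic_decomposition_solutions_iff:
  assumes D: "decomposition X A B \<phi>" and D': "decomposition X' A' B' \<phi>'"
  shows "(\<exists>\<sigma>. solution_iso X (decomposition_solution A B \<phi>)
              X' (decomposition_solution A' B' \<phi>') \<sigma>) \<longleftrightarrow> A \<approx> A' \<and> B \<approx> B'"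
proof
  assume "A \<approx> A' \<and> B \<approx> B'"
  then obtain \<alpha> \<beta> where \<alpha>\<beta>: "bij_betw \<alpha> A A'" "bij_betw \<beta> B B'" by (auto simp: eqpoll_def)
  define \<sigma> where "\<sigma> = \<phi>' \<circ> map_prod \<alpha> \<beta> \<circ> inv_into (A \<times> B) \<phi>"
  have "\<sigma> (\<phi> (a, b)) = \<phi>' (\<alpha> a, \<beta> b)" if "a \<in> A" "b \<in> B" for a b
    using D that by (simp add: \<sigma>_def decomposition_def bij_betw_def)
  with \<alpha>\<beta> show "\<exists>\<sigma>. solution_iso X (decomposition_solution A B \<phi>)
      X' (decomposition_solution A' B' \<phi>') \<sigma>"
    unfolding solution_iso_decomposition_iff[OF D D'] by blast
qed (auto simp: solution_iso_decomposition_iff[OF D D'] eqpoll_def)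

text \<open>
  The isomorphism is built in the direction from \<open>\<Sigma>\<^sub>A \<times> \<Sigma>\<^sub>B\<close>, where it has the formula
  \<open>(\<alpha>, \<beta>) \<mapsto> \<phi> \<circ> (\<alpha> \<times> \<beta>) \<circ> \<phi>\<^sup>-\<^sup>1\<close>; that it is onto is the splitting of automorphisms.
  Elements of \<open>BijGroup\<close> are extensional functions, whence the restrictions.
\<close>

lemma Aut_decomposition_solution:
  assumes D: "decomposition X A B \<phi>"
  shows "Aut_solution X (decomposition_solution A B \<phi>) \<cong> BijGroup A \<times>\<times> BijGroup B"
proof -
  let ?G = "BijGroup A \<times>\<times> BijGroup B" and ?H = "Aut_solution X (decomposition_solution A B \<phi>)"
  define F where "F = (\<lambda>(\<alpha>, \<beta>). \<lambda>x\<in>X. \<phi> (map_prod \<alpha> \<beta> (inv_into (A \<times> B) \<phi> x)))"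
  have F_apply: "F (\<alpha>, \<beta>) (\<phi> (a, b)) = \<phi> (\<alpha> a, \<beta> b)" if "a \<in> A" "b \<in> B" for \<alpha> \<beta> a b
    using D that decomposition_mem[OF D that] by (simp add: F_def decomposition_def bij_betw_def)
  have F_ext: "F p \<in> extensional X" for p by (simp add: F_def case_prod_beta)
  have ext_eqI: "f = g" if "f \<in> extensional X" "g \<in> extensional X"
    "\<And>a b. a \<in> A \<Longrightarrow> b \<in> B \<Longrightarrow> f (\<phi> (a, b)) = g (\<phi> (a, b))" for f g :: "'a \<Rightarrow> 'a"
    by (rule extensionalityI[OF that(1,2)]) (auto elim!: decomposition_cases[OF D] simp: that(3))
  have G_carrier: "carrier ?G = Bij A \<times> Bij B" by (simp add: DirProd_def BijGroup_def)
  have H_carrier: "\<sigma> \<in> carrier ?H \<longleftrightarrow> \<sigma> \<in> extensional X \<and>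
      solution_iso X (decomposition_solution A B \<phi>) X (decomposition_solution A B \<phi>) \<sigma>" for \<sigma>
    by (auto simp: Aut_solution_def Bij_def solution_iso_def)
  have H_mult: "\<sigma> \<otimes>\<^bsub>?H\<^esub> \<tau> = compose X \<sigma> \<tau>" if "\<sigma> \<in> carrier ?H" "\<tau> \<in> carrier ?H" for \<sigma> \<tau>
    using that by (simp add: Aut_solution_def BijGroup_def)
  have F_carrier: "F p \<in> carrier ?H" if p_mem: "p \<in> carrier ?G" for p
  proof -
    obtain \<alpha> \<beta> where p: "p = (\<alpha>, \<beta>)" "\<alpha> \<in> Bij A" "\<beta> \<in> Bij B"
      using p_mem unfolding G_carrier by blast
    then have "bij_betw \<alpha> A A" "bij_betw \<beta> B B" by (auto simp: Bij_def)
    then show ?thesis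
      unfolding H_carrier solution_iso_decomposition_iff[OF D D] p(1)
      using F_ext F_apply by blast
  qed
  have "F \<in> iso ?G ?H"
    unfolding iso_def
  proof (intro CollectI conjI homI)
    show "F p \<in> carrier ?H" if "p \<in> carrier ?G" for p by (rule F_carrier[OF that])
    show "F (p \<otimes>\<^bsub>?G\<^esub> q) = F p \<otimes>\<^bsub>?H\<^esub> F q" if pq: "p \<in> carrier ?G" "q \<in> carrier ?G" for p q
    proof -
      obtain \<alpha> \<beta> \<gamma> \<delta> where *: "p = (\<alpha>, \<beta>)" "q = (\<gamma>, \<delta>)" "\<alpha> \<in> Bij A" "\<gamma> \<in> Bij A"
        "\<beta> \<in> Bij B" "\<delta> \<in> Bij B"
        using pq unfolding G_carrier by blast
      then have mem: "\<gamma> a \<in> A" "\<delta> b \<in> B" if "a \<in> A" "b \<in> B" for a b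
        using that Bij_imp_funcset by blast+
      have "p \<otimes>\<^bsub>?G\<^esub> q = (compose A \<alpha> \<gamma>, compose B \<beta> \<delta>)"
        using * by (simp add: DirProd_def BijGroup_def)
      then have "F (p \<otimes>\<^bsub>?G\<^esub> q) = compose X (F p) (F q)"
        using * mem by (intro ext_eqI)
          (auto simp: F_ext F_apply compose_eq decomposition_mem[OF D])
      then show ?thesis using H_mult[OF F_carrier[OF pq(1)] F_carrier[OF pq(2)]] by simp
    qed
    show "bij_betw F (carrier ?G) (carrier ?H)"
      unfolding bij_betw_def
    proof
      show "inj_on F (carrier ?G)"
      proof (rule inj_onI)
        fix p q assume pq: "p \<in> carrier ?G" "q \<in> carrier ?G" "F p = F q"
        obtain \<alpha> \<beta> \<gamma> \<delta> where *: "p = (\<alpha>, \<beta>)" "q = (\<gamma>, \<delta>)" "\<alpha> \<in> Bij A" "\<gamma> \<in> Bij A"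
          "\<beta> \<in> Bij B" "\<delta> \<in> Bij B"
          using pq unfolding G_carrier by blast
        then have mem: "\<alpha> a \<in> A" "\<gamma> a \<in> A" "\<beta> b \<in> B" "\<delta> b \<in> B" if "a \<in> A" "b \<in> B" for a b
          using that Bij_imp_funcset by blast+
        have eq: "\<alpha> a = \<gamma> a \<and> \<beta> b = \<delta> b" if "a \<in> A" "b \<in> B" for a b
          using F_apply[OF that, of \<alpha> \<beta>] F_apply[OF that, of \<gamma> \<delta>] pq(3) *
            decomposition_eq_iff[OF D] mem[OF that] by simp
        obtain a0 b0 where "a0 \<in> A" "b0 \<in> B" using D by (auto simp: decomposition_def)
        then have "\<alpha> = \<gamma>" "\<beta> = \<delta>"
          using eq *(3-6) by (auto intro!: extensionalityI simp: Bij_def)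
        then show "p = q" using * by simp
      qed
      show "F ` carrier ?G = carrier ?H"
      proof
        show "F ` carrier ?G \<subseteq> carrier ?H" using F_carrier by blast
        show "carrier ?H \<subseteq> F ` carrier ?G"
        proof
          fix \<sigma> assume "\<sigma> \<in> carrier ?H"
          then obtain \<alpha> \<beta> where \<sigma>: "\<sigma> \<in> extensional X" and ab: "bij_betw \<alpha> A A" "bij_betw \<beta> B B"
            and split: "\<And>a b. a \<in> A \<Longrightarrow> b \<in> B \<Longrightarrow> \<sigma> (\<phi> (a, b)) = \<phi> (\<alpha> a, \<beta> b)"
            unfolding H_carrier solution_iso_decomposition_iff[OF D D] by blast
          have "(restrict \<alpha> A, restrict \<beta> B) \<in> carrier ?G"
            using ab unfolding G_carrier by (simp add: Bij_def)
          moreover have "\<sigma> = F (restrict \<alpha> A, restrict \<beta> B)"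
            using \<sigma> split by (intro ext_eqI) (auto simp: F_ext F_apply)
          ultimately show "\<sigma> \<in> F ` carrier ?G" by blast
        qed
      qed
    qed
  qed
  then have "?G \<cong> ?H" by (auto simp: is_iso_def)
  then show ?thesis
    by (rule group.iso_sym[OF DirProd_group[OF group_BijGroup group_BijGroup]])
qed

section \<open>Isomorphism classes\<close>

lemma solution_iso_id:
  assumes "\<forall>p\<in>X \<times> X. R p = R' p"
  shows "solution_iso X R X R' id"
  using assms by (simp add: solution_iso_def map_prod.id)

lemma solution_iso_sym:
  assumes "solution_iso X R X' R' \<sigma>" and R: "R \<in> X \<times> X \<rightarrow> X \<times> X"
  shows "solution_iso X' R' X R (inv_into X \<sigma>)"
proof -
  have bij: "bij_betw \<sigma> X X'"
    and hom: "\<And>p. p \<in> X \<times> X \<Longrightarrow> map_prod \<sigma> \<sigma> (R p) = R' (map_prod \<sigma> \<sigma> p)"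
    using assms by (auto simp: solution_iso_def)
  define \<tau> where "\<tau> = inv_into X \<sigma>"
  have "map_prod \<tau> \<tau> (R' q) = R (map_prod \<tau> \<tau> q)" if q: "q \<in> X' \<times> X'" for q
  proof -
    have p: "map_prod \<tau> \<tau> q \<in> X \<times> X"
      using q bij_betwE[OF bij_betw_inv_into[OF bij]] by (auto simp: \<tau>_def)
    have left: "map_prod \<tau> \<tau> (map_prod \<sigma> \<sigma> r) = r" if "r \<in> X \<times> X" for r
      using that bij by (auto simp: \<tau>_def bij_betw_inv_into_left)
    have "map_prod \<sigma> \<sigma> (map_prod \<tau> \<tau> q) = q"
      using q bij by (auto simp: \<tau>_def bij_betw_inv_into_right)
    then show ?thesis using hom[OF p] left[OF funcset_mem[OF R p]] by simp
  qed
  then show ?thesis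
    using bij_betw_inv_into[OF bij] by (simp add: solution_iso_def \<tau>_def)
qed

lemma solution_iso_trans:
  assumes \<sigma>: "solution_iso X R X' R' \<sigma>" and \<tau>: "solution_iso X' R' X'' R'' \<tau>"
  shows "solution_iso X R X'' R'' (\<tau> \<circ> \<sigma>)"
proof -
  have "map_prod (\<tau> \<circ> \<sigma>) (\<tau> \<circ> \<sigma>) (R p) = R'' (map_prod (\<tau> \<circ> \<sigma>) (\<tau> \<circ> \<sigma>) p)"
    if p: "p \<in> X \<times> X" for p
  proof -
    have "map_prod \<sigma> \<sigma> p \<in> X' \<times> X'"
      using p \<sigma> by (auto simp: solution_iso_def bij_betw_def)
    then have "map_prod \<tau> \<tau> (map_prod \<sigma> \<sigma> (R p)) = R'' (map_prod \<tau> \<tau> (map_prod \<sigma> \<sigma> p))"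
      using p \<sigma> \<tau> unfolding solution_iso_def o_apply by metis
    then show ?thesis by (simp add: map_prod_compose)
  qed
  then show ?thesis
    using \<sigma> \<tau> bij_betw_trans by (auto simp: solution_iso_def)
qed

lemma equiv_isomorphism_rel: "equiv (involutive_solutions X) (isomorphism_rel X)"
proof (rule equivI)
  show "isomorphism_rel X \<subseteq> involutive_solutions X \<times> involutive_solutions X"
    by (auto simp: isomorphism_rel_def)
  show "refl_on (involutive_solutions X) (isomorphism_rel X)"
    using solution_iso_id unfolding refl_on_def isomorphism_rel_def by blast
  show "sym (isomorphism_rel X)"
  proof (rule symI)
    fix R R' assume *: "(R, R') \<in> isomorphism_rel X"
    then have "R \<in> X \<times> X \<rightarrow> X \<times> X"
      by (simp add: isomorphism_rel_def involutive_solutions_def solution_def)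
    with * show "(R', R) \<in> isomorphism_rel X"
      using solution_iso_sym unfolding isomorphism_rel_def by blast
  qed
  show "trans (isomorphism_rel X)"
    unfolding trans_def isomorphism_rel_def using solution_iso_trans by fast
qed

lemma decomposition_solution_isomorphism_rel_iff:
  assumes "decomposition X A B \<phi>" "decomposition X A' B' \<phi>'"
  shows "(decomposition_solution A B \<phi>, decomposition_solution A' B' \<phi>') \<in> isomorphism_rel X \<longleftrightarrow>
    ((A, B, \<phi>), (A', B', \<phi>')) \<in> same_type"
  using assms isomorphic_decomposition_solutions_iff[OF assms]
  by (simp add: isomorphism_rel_def same_type_def decomposition_solution_involutive)

lemma same_type_refl: "(p, p) \<in> same_type"
  by (cases p) (simp add: same_type_def)

text \<open>
  Passing from a decomposition to its solution meets every isomorphism class and turns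
  \<open>same_type\<close> into isomorphism, so it carries representatives to representatives. Injectivity
  follows as well: equal solutions are isomorphic, so two representatives with the same solution
  have the same type.
\<close>

lemma representatives_decomposition_solutions:
  fixes X :: "'a set"
  assumes "X \<noteq> {}" and D: "system_of_representatives D (decompositions X) same_type"
  defines "f \<equiv> \<lambda>(A, B, \<phi>). decomposition_solution A B \<phi>"
  shows "inj_on f D"
    and "system_of_representatives (f ` D) (involutive_solutions X) (isomorphism_rel X)"
proof -
  note eqv = equiv_isomorphism_rel[of X]
  have sub: "D \<subseteq> decompositions X"
    and rep: "\<And>p. p \<in> decompositions X \<Longrightarrow> \<exists>!s. s \<in> D \<and> (p, s) \<in> same_type"
    using D by (auto simp: system_of_representatives_def)
  have f_iff: "(f p, f q) \<in> isomorphism_rel X \<longleftrightarrow> (p, q) \<in> same_type"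
    if "p \<in> decompositions X" "q \<in> decompositions X" for p q
    using that
    by (auto simp: f_def decompositions_def decomposition_solution_isomorphism_rel_iff)
  have f_mem: "f p \<in> involutive_solutions X" if "p \<in> decompositions X" for p
    using that by (auto simp: f_def decompositions_def decomposition_solution_involutive)
  have uniq: "p = q" if "p \<in> D" "q \<in> D" "(f p, f q) \<in> isomorphism_rel X" for p q
  proof -
    have "p \<in> decompositions X" "(p, q) \<in> same_type" using that f_iff sub by blast+
    then show ?thesis using rep[of p] same_type_refl[of p] that by blast
  qed
  show "inj_on f D"
  proof (rule inj_onI)
    fix p q assume pq: "p \<in> D" "q \<in> D" "f p = f q"
    then have "(f p, f p) \<in> isomorphism_rel X"
      using f_mem sub equiv_class_self[OF eqv] by blast
    then show "p = q" using uniq[OF pq(1,2)] pq(3) by simp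
  qed
  show "system_of_representatives (f ` D) (involutive_solutions X) (isomorphism_rel X)"
    unfolding system_of_representatives_def
  proof (intro conjI ballI)
    show "f ` D \<subseteq> involutive_solutions X" using f_mem sub by blast
    fix R assume R: "R \<in> involutive_solutions X"
    obtain A B :: "'a set" and \<phi> :: "'a \<times> 'a \<Rightarrow> 'a" where dec: "decomposition X A B \<phi>"
      and eq: "\<forall>p\<in>X \<times> X. R p = decomposition_solution A B \<phi> p"
      by (rule involutive_solution_decomposition[OF \<open>X \<noteq> {}\<close> R])
    have p: "(A, B, \<phi>) \<in> decompositions X" using dec by (simp add: decompositions_def)
    have Rp: "(R, f (A, B, \<phi>)) \<in> isomorphism_rel X"
      using solution_iso_id[OF eq] R f_mem[OF p] by (auto simp: isomorphism_rel_def f_def)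
    obtain s where s: "s \<in> D" "((A, B, \<phi>), s) \<in> same_type" using rep[OF p] by blast
    then have "(f (A, B, \<phi>), f s) \<in> isomorphism_rel X" using f_iff p sub by blast
    with Rp have Rs: "(R, f s) \<in> isomorphism_rel X"
      using eqv by (meson equiv_def transD)
    show "\<exists>!S. S \<in> f ` D \<and> (R, S) \<in> isomorphism_rel X"
    proof (rule ex1I[of _ "f s"])
      show "f s \<in> f ` D \<and> (R, f s) \<in> isomorphism_rel X" using s Rs by blast
      fix S assume "S \<in> f ` D \<and> (R, S) \<in> isomorphism_rel X"
      then obtain t where t: "t \<in> D" "S = f t" "(R, f t) \<in> isomorphism_rel X" by blast
      then have "(f t, f s) \<in> isomorphism_rel X"
        using Rs eqv by (meson equiv_def symD transD)
      then show "S = f s" using uniq[of t s] t s by simp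
    qed
  qed
qed

lemma bij_betw_representatives_quotient:
  assumes S: "system_of_representatives S M r" and r: "equiv M r"
  shows "bij_betw (\<lambda>s. r `` {s}) S (M // r)"
proof -
  have sub: "S \<subseteq> M" and rep: "\<And>x. x \<in> M \<Longrightarrow> \<exists>!s. s \<in> S \<and> (x, s) \<in> r"
    using S by (auto simp: system_of_representatives_def)
  have "inj_on (\<lambda>s. r `` {s}) S"
  proof (rule inj_onI)
    fix s t assume "s \<in> S" "t \<in> S" "r `` {s} = r `` {t}"
    moreover then have "(s, t) \<in> r" "(s, s) \<in> r"
      using r sub by (metis eq_equiv_class subsetD, metis equiv_def refl_onD subsetD)
    ultimately show "s = t" using rep sub by blast
  qed
  moreover have "(\<lambda>s. r `` {s}) ` S = M // r"
  proof
    show "(\<lambda>s. r `` {s}) ` S \<subseteq> M // r" using sub by (auto intro: quotientI)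
    show "M // r \<subseteq> (\<lambda>s. r `` {s}) ` S"
    proof
      fix C assume "C \<in> M // r"
      then obtain x where x: "x \<in> M" "C = r `` {x}" by (rule quotientE)
      obtain s where "s \<in> S" "(x, s) \<in> r" using rep[OF x(1)] by blast
      then show "C \<in> (\<lambda>s. r `` {s}) ` S"
        using x equiv_class_eq[OF r] by blast
    qed
  qed
  ultimately show ?thesis by (simp add: bij_betw_def)
qed

text \<open>
  The factors of a decomposition of an \<open>n\<close>-element set have \<open>d\<close> and \<open>n div d\<close> elements for a
  divisor \<open>d\<close> of \<open>n\<close>, and \<open>d\<close> alone fixes the type since \<open>n > 0\<close>. Conversely, for \<open>n = d * e\<close>
  any \<open>d\<close>-element and any \<open>e\<close>-element subset of \<open>X\<close> can serve as factors.
\<close>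

lemma finite_decompositions_representatives:
  assumes "X \<noteq> {}" and fin: "finite X"
  obtains D where "system_of_representatives D (decompositions X) same_type"
    "card D = card {d. d dvd card X}"
proof -
  let ?n = "card X"
  have n: "?n > 0" using assms by (simp add: card_gt_0_iff)
  have "\<exists>p. p \<in> decompositions X \<and> card (fst p) = d" if d: "d dvd ?n" for d
  proof -
    obtain e where e: "?n = d * e" using d by (rule dvdE)
    have "e dvd ?n" using e by simp
    then have "d \<le> ?n" "e \<le> ?n" using d n by (auto intro: dvd_imp_le)
    then obtain A B where A: "A \<subseteq> X" "card A = d" "finite A" and B: "B \<subseteq> X" "card B = e" "finite B"
      by (metis obtain_subset_with_card_n)
    have "card (A \<times> B) = card X" using A B e by (simp add: card_cartesian_product)
    then obtain \<phi> where "bij_betw \<phi> (A \<times> B) X"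
      using finite_same_card_bij[of "A \<times> B" X] A B fin by auto
    moreover have "A \<noteq> {}" "B \<noteq> {}" using A B e n by auto
    ultimately have "(A, B, \<phi>) \<in> decompositions X"
      by (simp add: decompositions_def decomposition_def)
    then show ?thesis using A by force
  qed
  then obtain c where c: "\<And>d. d dvd ?n \<Longrightarrow> c d \<in> decompositions X \<and> card (fst (c d)) = d"
    by metis
  have inj: "inj_on c {d. d dvd ?n}" using c by (intro inj_onI) (metis mem_Collect_eq)
  have factors: "finite A \<and> finite B \<and> ?n = card A * card B"
    if "(A, B, \<phi>) \<in> decompositions X" for A B :: "'a set" and \<phi>
  proof -
    have dec: "decomposition X A B \<phi>" using that by (simp add: decompositions_def)
    then have bij: "bij_betw \<phi> (A \<times> B) X" and ne: "A \<noteq> {}" "B \<noteq> {}"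
      by (auto simp: decomposition_def)
    have "?n = card (A \<times> B)" using bij_betw_same_card[OF bij] by simp
    moreover have "finite A" "finite B"
      using bij_betw_finite[OF bij] fin ne finite_cartesian_productD1 finite_cartesian_productD2
      by blast+
    ultimately show ?thesis by (simp add: card_cartesian_product)
  qed
  have type_iff: "(p, q) \<in> same_type \<longleftrightarrow> card (fst p) = card (fst q)"
    if pq: "p \<in> decompositions X" "q \<in> decompositions X" for p q
  proof -
    obtain A B \<phi> A' B' \<phi>' where *: "p = (A, B, \<phi>)" "q = (A', B', \<phi>')" by (metis prod_cases3)
    then have "finite A" "finite B" "finite A'" "finite B'"
      "?n = card A * card B" "?n = card A' * card B'"
      using factors pq by blast+
    then show ?thesis
      using * n by (auto simp: same_type_def eqpoll_iff_card)
  qed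
  have "system_of_representatives (c ` {d. d dvd ?n}) (decompositions X) same_type"
    unfolding system_of_representatives_def
  proof (intro conjI ballI)
    show "c ` {d. d dvd ?n} \<subseteq> decompositions X" using c by blast
    fix p assume p: "p \<in> decompositions X"
    obtain A B \<phi> where "p = (A, B, \<phi>)" by (metis prod_cases3)
    then have d: "card (fst p) dvd ?n" using factors p by fastforce
    show "\<exists>!s. s \<in> c ` {d. d dvd ?n} \<and> (p, s) \<in> same_type"
    proof (rule ex1I[of _ "c (card (fst p))"])
      show "c (card (fst p)) \<in> c ` {d. d dvd ?n} \<and> (p, c (card (fst p))) \<in> same_type"
        using c[OF d] d type_iff[OF p] by auto
      show "s = c (card (fst p))" if "s \<in> c ` {d. d dvd ?n} \<and> (p, s) \<in> same_type" for s
        using that c type_iff[OF p, of s] by auto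
    qed
  qed
  then show thesis using that card_image[OF inj] by blast
qed

lemma card_isomorphism_classes:
  assumes "X \<noteq> {}" "finite X"
  shows "card (involutive_solutions X // isomorphism_rel X) = card {d. d dvd card X}"
proof -
  obtain D where D: "system_of_representatives D (decompositions X) same_type"
    "card D = card {d. d dvd card X}"
    by (rule finite_decompositions_representatives[OF assms])
  note rep = representatives_decomposition_solutions[OF assms(1) D(1)]
  show ?thesis
    using bij_betw_same_card[OF bij_betw_representatives_quotient[OF rep(2) equiv_isomorphism_rel]]
      card_image[OF rep(1)] D(2) by simp
qed

theorem corollary2p12:
  fixes X :: "'a set"
  assumes "X \<noteq> {}"
  shows
    "(\<forall>R. solution X R \<longrightarrow> (involutive X R \<longleftrightarrow> diagonal X R)) \<and>
     (\<forall>R \<in> X \<times> X \<rightarrow> X \<times> X.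
        solution X R \<and> involutive X R \<longleftrightarrow>
        rectangular_semigroup X (dot R) \<and>
        (\<forall>x \<in> X. \<forall>y \<in> X. R (x, y) = (dot R x y, dot R y x))) \<and>
     (\<forall>D. system_of_representatives D (decompositions X) same_type \<longrightarrow>
        inj_on (\<lambda>(A, B, \<phi>). decomposition_solution A B \<phi>) D \<and>
        system_of_representatives
          ((\<lambda>(A, B, \<phi>). decomposition_solution A B \<phi>) ` D)
          (involutive_solutions X) (isomorphism_rel X)) \<and>
     (\<forall>(A :: 'b set) (B :: 'c set) \<phi>. decomposition X A B \<phi> \<longrightarrow>
        decomposition_solution A B \<phi> \<in> involutive_solutions X \<and>
        Aut_solution X (decomposition_solution A B \<phi>) \<cong> BijGroup A \<times>\<times> BijGroup B) \<and>
     (\<forall>n. finite X \<and> card X = n \<longrightarrow>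
        card (involutive_solutions X // isomorphism_rel X) = card {d. d dvd n})"
proof (intro conjI)
  show "\<forall>R. solution X R \<longrightarrow> (involutive X R \<longleftrightarrow> diagonal X R)"
    using involutive_iff_diagonal by blast
  show "\<forall>R \<in> X \<times> X \<rightarrow> X \<times> X.
        solution X R \<and> involutive X R \<longleftrightarrow>
        rectangular_semigroup X (dot R) \<and>
        (\<forall>x \<in> X. \<forall>y \<in> X. R (x, y) = (dot R x y, dot R y x))"
    using involutive_solution_iff_rectangular by blast
  show "\<forall>D. system_of_representatives D (decompositions X) same_type \<longrightarrow>
        inj_on (\<lambda>(A, B, \<phi>). decomposition_solution A B \<phi>) D \<and>
        system_of_representatives
          ((\<lambda>(A, B, \<phi>). decomposition_solution A B \<phi>) ` D)
          (involutive_solutions X) (isomorphism_rel X)"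
    using representatives_decomposition_solutions[OF assms] by blast
  show "\<forall>(A :: 'b set) (B :: 'c set) \<phi>. decomposition X A B \<phi> \<longrightarrow>
        decomposition_solution A B \<phi> \<in> involutive_solutions X \<and>
        Aut_solution X (decomposition_solution A B \<phi>) \<cong> BijGroup A \<times>\<times> BijGroup B"
    using decomposition_solution_involutive Aut_decomposition_solution by blast
  show "\<forall>n. finite X \<and> card X = n \<longrightarrow>
        card (involutive_solutions X // isomorphism_rel X) = card {d. d dvd n}"
    using card_isomorphism_classes[OF assms] by blast
qed

end
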